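(* For $a_1,a_2,a_3\in(0,+\infty)$ and independent $\gamma_1,\gamma_2,\gamma_3\sim\mathcal{N}(0,1)$, define $$E_1(a_1,a_2,a_3)=\mathbb{E}\left\{\frac{\sum_{i=1}^3a_i^2\gamma_i^2}{\sum_{i=1}^3a_i\gamma_i^2}\right\},\qquad E_2(a_1,a_2,a_3)=\mathbb{E}\left\{\sqrt{\sum_{i=1}^3a_i\gamma_i^2}\right\}.$$ Then for any real $\xi>0$ and $s\ne0$ such that $\xi>|s|$, $$E_1(\xi^2,\xi^2,s^2)=\xi^2\left\{1+\frac{s^2}{\xi^2}\frac{1}{\sqrt{1-\frac{s^2}{\xi^2}}}\log\frac{|s|}{\xi}+\frac{s^2}{\xi^2}\left(1-\frac{1}{\sqrt{1-\frac{s^2}{\xi^2}}}\log\left(1+\sqrt{1-\tfrac{s^2}{\xi^2}}\right)\right)\right\},$$ $$E_2(\xi^2,\xi^2,s^2)=\xi\sqrt{\frac2\pi}\,\frac{\arcsin\sqrt{1-\frac{s^2}{\xi^2}}}{\sqrt{1-\frac{s^2}{\xi^2}}}+|s|\sqrt{\frac2\pi}.$$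
   Context: All notation is standard and introduced in the claim. *)

theory Defs
  imports "HOL-Probability.Probability"
begin

definition indep_std_normals :: "'a measure \<Rightarrow> (nat \<Rightarrow> 'a \<Rightarrow> real) \<Rightarrow> nat set \<Rightarrow> bool" where
  "indep_std_normals M \<gamma> I \<longleftrightarrow>
     prob_space.indep_vars M (\<lambda>_. borel) \<gamma> I \<and>
     (\<forall>i\<in>I. distributed M lborel (\<gamma> i) std_normal_density)"

text \<open>In \<open>E1\<close> the denominator vanishes only on a null set when the \<open>a\<^sub>i\<close> are positive, so the
  convention \<open>x / 0 = 0\<close> does not affect the expectation.\<close>

definition E1 :: "'a measure \<Rightarrow> (nat \<Rightarrow> 'a \<Rightarrow> real) \<Rightarrow> real \<Rightarrow> real \<Rightarrow> real \<Rightarrow> real" where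
  "E1 M \<gamma> a\<^sub>1 a\<^sub>2 a\<^sub>3 =
     (LINT \<omega>|M. (a\<^sub>1\<^sup>2 * (\<gamma> 1 \<omega>)\<^sup>2 + a\<^sub>2\<^sup>2 * (\<gamma> 2 \<omega>)\<^sup>2 + a\<^sub>3\<^sup>2 * (\<gamma> 3 \<omega>)\<^sup>2) /
                (a\<^sub>1 * (\<gamma> 1 \<omega>)\<^sup>2 + a\<^sub>2 * (\<gamma> 2 \<omega>)\<^sup>2 + a\<^sub>3 * (\<gamma> 3 \<omega>)\<^sup>2))"

definition E2 :: "'a measure \<Rightarrow> (nat \<Rightarrow> 'a \<Rightarrow> real) \<Rightarrow> real \<Rightarrow> real \<Rightarrow> real \<Rightarrow> real" where
  "E2 M \<gamma> a\<^sub>1 a\<^sub>2 a\<^sub>3 =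
     (LINT \<omega>|M. sqrt (a\<^sub>1 * (\<gamma> 1 \<omega>)\<^sup>2 + a\<^sub>2 * (\<gamma> 2 \<omega>)\<^sup>2 + a\<^sub>3 * (\<gamma> 3 \<omega>)\<^sup>2))"

end

theory Submission
  imports Defs "HOL-Real_Asymp.Real_Asymp"
begin

text \<open>Write \<open>N\<close> for the numerator and \<open>D\<close> for the quadratic form in the denominator. Then
  \<open>N / D\<close> is the integral of \<open>N exp (- t D)\<close> and \<open>sqrt D\<close> is \<open>2 / sqrt pi\<close> times the
  integral of \<open>D exp (- t\<^sup>2 D)\<close> over \<open>t \<ge> 0\<close>. By Tonelli the expectation can be taken first,
  and independence factors it into one-dimensional Gaussian moments. For two equal weights \<open>a\<close>
  and a smaller third weight \<open>c\<close>, the remaining integral in \<open>t\<close> is made rational by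
  \<open>u = 1 / sqrt (1 + 2 t c)\<close> for \<open>E1\<close> and \<open>v = t / sqrt (1 + 2 t\<^sup>2 c)\<close> for \<open>E2\<close>.\<close>

section \<open>One-dimensional Gaussian moments with an exponential weight\<close>

lemma normal_density_0_inverse_sqrt:
  assumes "0 < (q :: real)"
  shows "normal_density 0 (1 / sqrt q) x = sqrt q / sqrt (2 * pi) * exp (- q * x\<^sup>2 / 2)"
  using assms by (simp add: normal_density_def real_sqrt_mult real_sqrt_divide power_divide)

text \<open>The weight only changes the variance: the standard density times
  \<open>exp (- b * x^2)\<close> is \<open>1 / sqrt (1 + 2 * b)\<close> times the centred normal
  density of variance \<open>1 / (1 + 2 * b)\<close>, whose even moments are known.\<close>

lemma has_bochner_integral_std_normal_exp:
  assumes "0 \<le> (b :: real)"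
  shows "has_bochner_integral lborel (\<lambda>x. std_normal_density x * (x ^ (2 * k) * exp (- b * x\<^sup>2)))
    (fact (2 * k) / ((2 * (1 + 2 * b)) ^ k * fact k) * (1 / sqrt (1 + 2 * b)))"
proof -
  let ?q = "1 + 2 * b"
  have q: "0 < ?q" using assms by simp
  have "std_normal_density x * (x ^ (2 * k) * exp (- b * x\<^sup>2))
      = normal_density 0 (1 / sqrt ?q) x * (x - 0) ^ (2 * k) * (1 / sqrt ?q)" for x :: real
  proof -
    have "exp (- x\<^sup>2 / 2) * exp (- b * x\<^sup>2) = exp (- ?q * x\<^sup>2 / 2)"
      by (simp add: exp_add[symmetric] field_simps)
    then show ?thesis
      using q by (simp add: normal_density_0_inverse_sqrt std_normal_density_def field_simps)
  qed
  moreover have "2 / (1 / sqrt ?q)\<^sup>2 = 2 * ?q"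
    using q by (simp add: power_divide)
  ultimately show ?thesis
    using q has_bochner_integral_mult_left[OF normal_moment_even[where \<mu> = 0 and \<sigma> = "1 / sqrt ?q" and k = k], of "1 / sqrt ?q"]
    by simp
qed

lemma nn_integral_std_normal_exp:
  assumes X: "distributed M lborel X std_normal_density" and b: "0 \<le> (b :: real)"
  shows "(\<integral>\<^sup>+\<omega>. ennreal (exp (- b * (X \<omega>)\<^sup>2)) \<partial>M) = ennreal (1 / sqrt (1 + 2 * b))"
    and "(\<integral>\<^sup>+\<omega>. ennreal ((X \<omega>)\<^sup>2 * exp (- b * (X \<omega>)\<^sup>2)) \<partial>M)
      = ennreal (1 / (1 + 2 * b) * (1 / sqrt (1 + 2 * b)))"
proof -
  have *: "(\<integral>\<^sup>+\<omega>. ennreal ((X \<omega>) ^ (2 * k) * exp (- b * (X \<omega>)\<^sup>2)) \<partial>M)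
      = ennreal (fact (2 * k) / ((2 * (1 + 2 * b)) ^ k * fact k) * (1 / sqrt (1 + 2 * b)))" for k
  proof -
    have "(\<integral>\<^sup>+\<omega>. ennreal ((X \<omega>) ^ (2 * k) * exp (- b * (X \<omega>)\<^sup>2)) \<partial>M)
      = (\<integral>\<^sup>+x. ennreal (std_normal_density x) * ennreal (x ^ (2 * k) * exp (- b * x\<^sup>2)) \<partial>lborel)"
      by (rule distributed_nn_integral[OF X, symmetric]) measurable
    also have "\<dots> = (\<integral>\<^sup>+x. ennreal (std_normal_density x * (x ^ (2 * k) * exp (- b * x\<^sup>2))) \<partial>lborel)"
      by (simp add: ennreal_mult')
    also have "\<dots> = ennreal (fact (2 * k) / ((2 * (1 + 2 * b)) ^ k * fact k) * (1 / sqrt (1 + 2 * b)))"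
      by (rule nn_integral_eq_integral[THEN trans])
        (use has_bochner_integral_std_normal_exp[OF b, of k] in \<open>auto simp: has_bochner_integral_iff\<close>)
    finally show ?thesis .
  qed
  show "(\<integral>\<^sup>+\<omega>. ennreal (exp (- b * (X \<omega>)\<^sup>2)) \<partial>M) = ennreal (1 / sqrt (1 + 2 * b))"
    using *[of 0] by simp
  show "(\<integral>\<^sup>+\<omega>. ennreal ((X \<omega>)\<^sup>2 * exp (- b * (X \<omega>)\<^sup>2)) \<partial>M)
      = ennreal (1 / (1 + 2 * b) * (1 / sqrt (1 + 2 * b)))"
    using *[of 1] b by (simp add: divide_simps)
qed

section \<open>Expectations of weighted quadratic forms of independent normals\<close>

context prob_space
begin

text \<open>The exponential of a sum is a product over \<open>I\<close>, and the square is absorbed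
  into the factor of index \<open>j\<close>. Independence then leaves a product of the moments of
  order 0 and, at \<open>j\<close>, of order 2.\<close>

lemma nn_integral_indep_std_normals_sq_exp:
  assumes \<gamma>: "indep_std_normals M \<gamma> I" and I: "finite I" "j \<in> I"
    and b: "\<And>i. i \<in> I \<Longrightarrow> 0 \<le> b i"
  shows "(\<integral>\<^sup>+\<omega>. ennreal ((\<gamma> j \<omega>)\<^sup>2 * exp (- (\<Sum>i\<in>I. b i * (\<gamma> i \<omega>)\<^sup>2))) \<partial>M)
    = ennreal (1 / (1 + 2 * b j) * (\<Prod>i\<in>I. 1 / sqrt (1 + 2 * b i)))"
proof -
  have indep: "indep_vars (\<lambda>_. borel) \<gamma> I"
    and dist: "\<And>i. i \<in> I \<Longrightarrow> distributed M lborel (\<gamma> i) std_normal_density"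
    using \<gamma> by (auto simp: indep_std_normals_def)
  define f where "f i x = ennreal ((if i = j then x\<^sup>2 else 1) * exp (- b i * x\<^sup>2))" for i and x :: real
  have "ennreal ((\<gamma> j \<omega>)\<^sup>2 * exp (- (\<Sum>i\<in>I. b i * (\<gamma> i \<omega>)\<^sup>2))) = (\<Prod>i\<in>I. f i (\<gamma> i \<omega>))" for \<omega>
    using I by (simp add: f_def prod_ennreal prod.distrib exp_sum sum_negf[symmetric])
  then have "(\<integral>\<^sup>+\<omega>. ennreal ((\<gamma> j \<omega>)\<^sup>2 * exp (- (\<Sum>i\<in>I. b i * (\<gamma> i \<omega>)\<^sup>2))) \<partial>M)
      = (\<integral>\<^sup>+\<omega>. (\<Prod>i\<in>I. f i (\<gamma> i \<omega>)) \<partial>M)"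
    by simp
  also have "\<dots> = (\<Prod>i\<in>I. \<integral>\<^sup>+\<omega>. f i (\<gamma> i \<omega>) \<partial>M)"
    by (intro indep_vars_nn_integral I indep_vars_compose2[OF indep])
      (auto simp: f_def[abs_def])
  also have "\<dots> = (\<Prod>i\<in>I. ennreal ((if i = j then 1 / (1 + 2 * b j) else 1) * (1 / sqrt (1 + 2 * b i))))"
    by (intro prod.cong refl)
      (auto simp: f_def nn_integral_std_normal_exp[OF dist b, simplified])
  also have "\<dots> = ennreal (1 / (1 + 2 * b j) * (\<Prod>i\<in>I. 1 / sqrt (1 + 2 * b i)))"
    using I b[of j] by (subst prod_ennreal) (auto simp only: prod.distrib prod.delta' prod.delta,
      auto simp: b)
  finally show ?thesis .
qed

lemma nn_integral_indep_std_normals_form_exp: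
  assumes \<gamma>: "indep_std_normals M \<gamma> I" and I: "finite I"
    and b: "\<And>i. i \<in> I \<Longrightarrow> 0 \<le> b i" and w: "\<And>i. i \<in> I \<Longrightarrow> 0 \<le> w i"
  shows "(\<integral>\<^sup>+\<omega>. ennreal ((\<Sum>i\<in>I. w i * (\<gamma> i \<omega>)\<^sup>2) * exp (- (\<Sum>i\<in>I. b i * (\<gamma> i \<omega>)\<^sup>2))) \<partial>M)
    = ennreal ((\<Sum>i\<in>I. w i / (1 + 2 * b i)) * (\<Prod>i\<in>I. 1 / sqrt (1 + 2 * b i)))"
proof -
  let ?e = "\<lambda>\<omega>. exp (- (\<Sum>i\<in>I. b i * (\<gamma> i \<omega>)\<^sup>2))"
  have m[measurable]: "\<And>i. i \<in> I \<Longrightarrow> \<gamma> i \<in> borel_measurable M"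
    using \<gamma> by (auto simp: indep_std_normals_def indep_vars_def)
  have "(\<integral>\<^sup>+\<omega>. ennreal ((\<Sum>i\<in>I. w i * (\<gamma> i \<omega>)\<^sup>2) * ?e \<omega>) \<partial>M)
    = (\<integral>\<^sup>+\<omega>. (\<Sum>j\<in>I. ennreal (w j) * ennreal ((\<gamma> j \<omega>)\<^sup>2 * ?e \<omega>)) \<partial>M)"
    using w by (intro nn_integral_cong)
      (simp add: ennreal_mult[symmetric] sum_ennreal sum_distrib_right mult.assoc)
  also have "\<dots> = (\<Sum>j\<in>I. ennreal (w j) * (\<integral>\<^sup>+\<omega>. ennreal ((\<gamma> j \<omega>)\<^sup>2 * ?e \<omega>) \<partial>M))"
    by (subst nn_integral_sum) (auto intro!: sum.cong nn_integral_cmult)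
  also have "\<dots> = (\<Sum>j\<in>I. ennreal (w j / (1 + 2 * b j) * (\<Prod>i\<in>I. 1 / sqrt (1 + 2 * b i))))"
    by (intro sum.cong refl)
      (simp add: nn_integral_indep_std_normals_sq_exp[OF \<gamma> I _ b] w b ennreal_mult'[symmetric])
  also have "\<dots> = ennreal ((\<Sum>i\<in>I. w i / (1 + 2 * b i)) * (\<Prod>i\<in>I. 1 / sqrt (1 + 2 * b i)))"
    using w b by (subst sum_ennreal) (auto simp: sum_distrib_right intro!: mult_nonneg_nonneg
      divide_nonneg_nonneg prod_nonneg add_nonneg_nonneg)
  finally show ?thesis .
qed

text \<open>\<open>T\<close> is left general so that one exchange of integrals serves both
  expectations, with \<open>T t = t\<close> for \<open>E1\<close> and \<open>T t = t^2\<close> for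
  \<open>E2\<close>. Nonnegative integrals let Tonelli apply on measurability alone.\<close>

lemma nn_integral_indep_std_normals_mixture:
  assumes \<gamma>: "indep_std_normals M \<gamma> I" and I: "finite I"
    and a: "\<And>i. i \<in> I \<Longrightarrow> 0 \<le> a i" and w: "\<And>i. i \<in> I \<Longrightarrow> 0 \<le> w i"
    and T[measurable]: "T \<in> borel_measurable borel" and T0: "\<And>t :: real. 0 \<le> t \<Longrightarrow> 0 \<le> T t"
  shows "(\<integral>\<^sup>+\<omega>. (\<integral>\<^sup>+t. ennreal ((\<Sum>i\<in>I. w i * (\<gamma> i \<omega>)\<^sup>2) * exp (- T t * (\<Sum>i\<in>I. a i * (\<gamma> i \<omega>)\<^sup>2)))
      * indicator {0..} t \<partial>lborel) \<partial>M)
    = (\<integral>\<^sup>+t. ennreal ((\<Sum>i\<in>I. w i / (1 + 2 * (T t * a i))) * (\<Prod>i\<in>I. 1 / sqrt (1 + 2 * (T t * a i))))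
      * indicator {0..} t \<partial>lborel)"
proof -
  interpret pair_sigma_finite M "lborel :: real measure"
    by unfold_locales
  have m[measurable]: "\<And>i. i \<in> I \<Longrightarrow> \<gamma> i \<in> borel_measurable M"
    using \<gamma> by (auto simp: indep_std_normals_def indep_vars_def)
  let ?g = "\<lambda>\<omega> t. ennreal ((\<Sum>i\<in>I. w i * (\<gamma> i \<omega>)\<^sup>2) * exp (- T t * (\<Sum>i\<in>I. a i * (\<gamma> i \<omega>)\<^sup>2)))"
  have "(\<integral>\<^sup>+\<omega>. (\<integral>\<^sup>+t. ?g \<omega> t * indicator {0..} t \<partial>lborel) \<partial>M)
    = (\<integral>\<^sup>+t. (\<integral>\<^sup>+\<omega>. ?g \<omega> t * indicator {0..} t \<partial>M) \<partial>lborel)"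
    by (rule Fubini'[symmetric]) measurable
  also have "\<dots> = (\<integral>\<^sup>+t. (\<integral>\<^sup>+\<omega>. ?g \<omega> t \<partial>M) * indicator {0..} t \<partial>lborel)"
    by (intro nn_integral_cong nn_integral_multc) measurable
  also have "\<dots> = (\<integral>\<^sup>+t. ennreal ((\<Sum>i\<in>I. w i / (1 + 2 * (T t * a i))) * (\<Prod>i\<in>I. 1 / sqrt (1 + 2 * (T t * a i))))
      * indicator {0..} t \<partial>lborel)"
  \<comment> \<open>The expectation is evaluated only for \<open>0 \<le> t\<close>, where the
    coefficients \<open>T t * a i\<close> are nonnegative; for negative \<open>t\<close> the
    indicator makes both sides vanish.\<close>
  proof (intro nn_integral_cong)
    fix t :: real
    have "(\<integral>\<^sup>+\<omega>. ?g \<omega> t \<partial>M) = ennreal ((\<Sum>i\<in>I. w i / (1 + 2 * (T t * a i))) *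
        (\<Prod>i\<in>I. 1 / sqrt (1 + 2 * (T t * a i))))" if "0 \<le> t"
      using nn_integral_indep_std_normals_form_exp[OF \<gamma> I, of "\<lambda>i. T t * a i" w] that a w T0
      by (simp add: sum_distrib_left mult.assoc sum_negf)
    then show "(\<integral>\<^sup>+\<omega>. ?g \<omega> t \<partial>M) * indicator {0..} t = ennreal ((\<Sum>i\<in>I. w i / (1 + 2 * (T t * a i))) *
        (\<Prod>i\<in>I. 1 / sqrt (1 + 2 * (T t * a i)))) * indicator {0..} t"
      by (auto simp: indicator_def)
  qed
  finally show ?thesis .
qed

end

section \<open>Integral representations of a quotient and of a square root\<close>

lemma nn_integral_exp_atLeast_0:
  assumes "0 \<le> (N :: real)" "0 \<le> D" "D = 0 \<Longrightarrow> N = 0"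
  shows "(\<integral>\<^sup>+t. ennreal (N * exp (- t * D)) * indicator {0..} t \<partial>lborel) = ennreal (N / D)"
proof (cases "D = 0")
  case False
  then have "0 < D" using assms by simp
  have "(\<integral>\<^sup>+t. ennreal (N * exp (- t * D)) * indicator {0..} t \<partial>lborel)
      = ennreal (0 - (- N / D * exp (- 0 * D)))"
  proof (rule nn_integral_FTC_atLeast)
    show "((\<lambda>t. - N / D * exp (- t * D)) \<longlongrightarrow> 0) at_top"
      using \<open>0 < D\<close> by real_asymp
    show "DERIV (\<lambda>t. - N / D * exp (- t * D)) x :> N * exp (- x * D)" for x
      using \<open>0 < D\<close> by (auto intro!: derivative_eq_intros)
  qed (use assms in auto)
  then show ?thesis by simp
\<comment> \<open>If \<open>D = 0\<close> then \<open>N = 0\<close>, so both sides are 0, the right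
  one because \<open>0 / 0 = 0\<close>.\<close>
qed (use assms in simp)

text \<open>Rescaling the Gaussian integral over the half-line, which is \<open>sqrt pi / 2\<close>,
  by \<open>sqrt D\<close> uses up one factor \<open>sqrt D\<close> of \<open>D\<close>; the other
  one remains.\<close>

lemma nn_integral_gauss_atLeast_0:
  assumes "0 \<le> (D :: real)"
  shows "(\<integral>\<^sup>+t. ennreal (D * exp (- t\<^sup>2 * D)) * indicator {0..} t \<partial>lborel) = ennreal (sqrt pi / 2 * sqrt D)"
proof (cases "D = 0")
  case False
  then have D: "0 < D" using assms by simp
  have "ennreal (sqrt pi / 2) = (\<integral>\<^sup>+x. ennreal (indicator {0..} x *\<^sub>R exp (- x\<^sup>2)) \<partial>lborel)"
    using gaussian_moment_0 by (subst nn_integral_eq_integral) (auto simp: has_bochner_integral_iff)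
  also have "\<dots> = ennreal (sqrt D) * (\<integral>\<^sup>+x. ennreal (indicator {0..} (0 + sqrt D * x) *\<^sub>R exp (- (0 + sqrt D * x)\<^sup>2)) \<partial>lborel)"
    using D by (subst nn_integral_real_affine[where c = "sqrt D" and t = 0]) auto
  finally have *: "ennreal (sqrt pi / 2) = \<dots>" .
  have "(\<integral>\<^sup>+t. ennreal (D * exp (- t\<^sup>2 * D)) * indicator {0..} t \<partial>lborel)
      = (\<integral>\<^sup>+x. ennreal D * ennreal (indicator {0..} (0 + sqrt D * x) *\<^sub>R exp (- (0 + sqrt D * x)\<^sup>2)) \<partial>lborel)"
    using D by (intro nn_integral_cong)
      (auto simp: indicator_def ennreal_mult[symmetric] power_mult_distrib zero_le_mult_iff mult.commute)
  also have "\<dots> = ennreal (sqrt D) * (ennreal (sqrt D) * (\<integral>\<^sup>+x. ennreal (indicator {0..} (0 + sqrt D * x) *\<^sub>R exp (- (0 + sqrt D * x)\<^sup>2)) \<partial>lborel))"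
    using D by (subst nn_integral_cmult) (auto simp: mult.assoc[symmetric] ennreal_mult[symmetric])
  also have "\<dots> = ennreal (sqrt pi / 2 * sqrt D)"
    using D unfolding *[symmetric] by (simp add: ennreal_mult[symmetric] mult.commute)
  finally show ?thesis .
qed simp

section \<open>The remaining integrals in \<open>t\<close>, by explicit antiderivatives\<close>

lemma nn_integral_E1_kernel:
  assumes "0 < (c :: real)" "c < a"
  defines "r \<equiv> sqrt (1 - c / a)"
  shows "(\<integral>\<^sup>+t. ennreal ((2 * (a\<^sup>2 / (1 + 2 * (t * a))) + c\<^sup>2 / (1 + 2 * (t * c))) *
        (1 / ((1 + 2 * (t * a)) * sqrt (1 + 2 * (t * c))))) * indicator {0..} t \<partial>lborel)
     = ennreal (a - c * (ln ((1 + r) / (1 - r)) / (2 * r) - 1))"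
proof -
  have r: "0 < r" "r < 1" "a * r\<^sup>2 = a - c"
    using assms by (auto simp: r_def field_simps)
  let ?p = "\<lambda>t. 1 + 2 * (t * a)" and ?q = "\<lambda>t. 1 + 2 * (t * c)"
  \<comment> \<open>This is artanh(r u) / r - u, the antiderivative of r^2 u^2 / (1 - r^2 u^2) that
    vanishes at 0.\<close>
  define G where "G u = ln ((1 + r * u) / (1 - r * u)) / (2 * r) - u" for u
  \<comment> \<open>With u = 1 / sqrt q, the integrand is 2 a^2 u / p^2 + c^2 u^3 / p. The second
    term of \<open>F\<close> produces the part with p^2 together with a c u^3 / p; the excess c (a -
    c) u^3 / p is removed by the term with \<open>G\<close>. At infinity u tends to 0, so both terms
    vanish.\<close>
  define F where "F t = c * G (1 / sqrt (?q t)) - a / (?p t * sqrt (?q t))" for t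
  have "(\<integral>\<^sup>+t. ennreal ((2 * (a\<^sup>2 / ?p t) + c\<^sup>2 / ?q t) * (1 / (?p t * sqrt (?q t)))) * indicator {0..} t \<partial>lborel)
     = ennreal (0 - F 0)"
  proof (rule nn_integral_FTC_atLeast)
    show "(F \<longlongrightarrow> 0) at_top"
      unfolding F_def G_def using assms(1,2) r by real_asymp
  next
    fix x :: real assume x: "0 \<le> x"
    define u where "u = 1 / sqrt (?q x)"
    have q: "1 \<le> ?q x" and p: "1 \<le> ?p x" using x assms by simp_all
    have u: "0 < u" "u \<le> 1" "u\<^sup>2 = 1 / ?q x"
    proof -
      have "0 < ?q x" "1 \<le> sqrt (?q x)" using q by (linarith, rule real_sqrt_ge_one)
      then show "0 < u" "u \<le> 1" "u\<^sup>2 = 1 / ?q x" by (simp_all add: u_def power_divide)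
    qed
    \<comment> \<open>This keeps the argument of the logarithm in \<open>G\<close> positive and 1 -
      r^2 u^2 away from 0.\<close>
    have ru: "r * u < 1" using r u mult_left_le[of u r] by linarith
    have du: "((\<lambda>t. 1 / sqrt (?q t)) has_real_derivative - c * u ^ 3) (at x)"
    proof -
      have "0 < ?q x" using q by linarith
      moreover from this have "sqrt (?q x) ^ 3 = ?q x * sqrt (?q x)" by (simp add: power3_eq_cube)
      ultimately show ?thesis
        unfolding u_def by (auto intro!: derivative_eq_intros simp: power_divide divide_simps)
    qed
    have dG: "(G has_real_derivative r\<^sup>2 * u\<^sup>2 / (1 - r\<^sup>2 * u\<^sup>2)) (at u)"
    proof -
      have "0 < 1 + r * u" using r u by (simp add: add_pos_pos)
      have "1 - r\<^sup>2 * u\<^sup>2 = (1 + r * u) * (1 - r * u)" by algebra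
      then show ?thesis
        unfolding G_def using r ru \<open>0 < 1 + r * u\<close>
        by (auto intro!: derivative_eq_intros simp: divide_simps) (auto simp: algebra_simps power2_eq_square)
    qed
    have dG': "((\<lambda>t. G (1 / sqrt (?q t))) has_real_derivative
        r\<^sup>2 * u\<^sup>2 / (1 - r\<^sup>2 * u\<^sup>2) * (- c * u ^ 3)) (at x)"
    proof (rule DERIV_chain2[where f = G, OF _ du])
      have "1 / sqrt (?q x) = u" by (simp add: u_def)
      then show "(G has_real_derivative r\<^sup>2 * u\<^sup>2 / (1 - r\<^sup>2 * u\<^sup>2)) (at (1 / sqrt (?q x)))"
        using dG by simp
    qed
    have dp: "((\<lambda>t. a / (?p t * sqrt (?q t))) has_real_derivative
        - a * (2 * a * u / (?p x)\<^sup>2 + c * u ^ 3 / ?p x)) (at x)"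
    proof -
      have "0 < ?p x" using p by linarith
      then have "((\<lambda>t. a / ?p t) has_real_derivative - a * (2 * a) / (?p x)\<^sup>2) (at x)"
        by (auto intro!: derivative_eq_intros simp: power2_eq_square)
      from DERIV_mult'[OF this du] have "((\<lambda>t. a / ?p t * (1 / sqrt (?q t))) has_real_derivative
          - a * (2 * a * u / (?p x)\<^sup>2 + c * u ^ 3 / ?p x)) (at x)"
        by (rule DERIV_cong) (simp add: u_def algebra_simps)
      then show ?thesis by simp
    qed
    \<comment> \<open>The choice of \<open>r\<close> pays off here: 1 - r^2 u^2 equals c p / (a q),
      so the derivative of \<open>G\<close> has the denominator p of the integrand.\<close>
    have key: "r\<^sup>2 * u\<^sup>2 / (1 - r\<^sup>2 * u\<^sup>2) = (a - c) / (c * ?p x)"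
    proof -
      have nz: "?q x \<noteq> 0" "a \<noteq> 0" using q assms by linarith+
      then have aq: "a * ?q x \<noteq> 0" by simp
      have "r\<^sup>2 = (a - c) / a" using r assms by (simp add: field_simps)
      then have ru2: "r\<^sup>2 * u\<^sup>2 = (a - c) / (a * ?q x)" by (simp add: u(3))
      have "1 - (a - c) / (a * ?q x) = (a * ?q x - (a - c)) / (a * ?q x)"
        by (simp only: diff_divide_distrib[of "a * ?q x"] divide_self[OF aq])
      also have "a * ?q x - (a - c) = c * ?p x" by algebra
      finally show ?thesis unfolding ru2 using nz by simp
    qed
    have "(F has_real_derivative c * ((a - c) / (c * ?p x) * (- c * u ^ 3)) +
        a * (2 * a * u / (?p x)\<^sup>2 + c * u ^ 3 / ?p x)) (at x)"
      unfolding F_def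
      by (rule DERIV_diff[THEN DERIV_cong, OF DERIV_cmult[OF dG'] dp]) (simp add: key)
    also have "c * ((a - c) / (c * ?p x) * (- c * u ^ 3)) + a * (2 * a * u / (?p x)\<^sup>2 + c * u ^ 3 / ?p x)
       = (2 * (a\<^sup>2 / ?p x) + c\<^sup>2 * u\<^sup>2) * (u / ?p x)"
      using p assms by (simp add: divide_simps) (simp add: algebra_simps power2_eq_square power3_eq_cube)
    also have "\<dots> = (2 * (a\<^sup>2 / ?p x) + c\<^sup>2 / ?q x) * (1 / (?p x * sqrt (?q x)))"
      by (simp add: u(3)) (simp add: u_def)
    finally show "(F has_real_derivative \<dots>) (at x)" .
    show "0 \<le> (2 * (a\<^sup>2 / ?p x) + c\<^sup>2 / ?q x) * (1 / (?p x * sqrt (?q x)))"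
      using p q by (intro mult_nonneg_nonneg add_nonneg_nonneg) auto
  qed simp
  also have "0 - F 0 = a - c * (ln ((1 + r) / (1 - r)) / (2 * r) - 1)"
    by (simp add: F_def G_def)
  finally show ?thesis .
qed

lemma nn_integral_E2_kernel:
  assumes "0 < (c :: real)" "c < a"
  shows "(\<integral>\<^sup>+t. ennreal ((2 * (a / (1 + 2 * (t\<^sup>2 * a))) + c / (1 + 2 * (t\<^sup>2 * c))) *
        (1 / ((1 + 2 * (t\<^sup>2 * a)) * sqrt (1 + 2 * (t\<^sup>2 * c))))) * indicator {0..} t \<partial>lborel)
     = ennreal (sqrt (c / 2) + a / sqrt (2 * (a - c)) * arctan (sqrt ((a - c) / c)))"
proof -
  let ?p = "\<lambda>t. 1 + 2 * (t\<^sup>2 * a)" and ?q = "\<lambda>t. 1 + 2 * (t\<^sup>2 * c)"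
  \<comment> \<open>Chosen so that 1 + K v^2 = p / q for v = t / sqrt q.\<close>
  define K where "K = 2 * (a - c)"
  define k where "k = sqrt K"
  have K: "0 < K" "0 < k" "k\<^sup>2 = K" using assms by (auto simp: K_def k_def)
  \<comment> \<open>Put m = 1 + K v^2. Since dv = dt / q^(3/2) and 1 / q = 1 - 2 c v^2, the
    integrand becomes (2 a + c m) (1 - 2 c v^2) / m^2 in v. Partial fractions give
    \<open>H\<close>.\<close>
  define H where "H v = 2 * a\<^sup>2 / K * (v / (1 + K * v\<^sup>2)) - 2 * c\<^sup>2 / K * v + a / k * arctan (k * v)" for v
  define F where "F t = H (t / sqrt (?q t))" for t
  \<comment> \<open>The range of v ends at the finite value \<open>1 / sqrt (2 * c)\<close>, so the
    integral is the value of \<open>H\<close> there minus \<open>H 0 = 0\<close>.\<close>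
  have v_lim: "((\<lambda>t. t / sqrt (?q t)) \<longlongrightarrow> 1 / sqrt (2 * c)) at_top"
  proof -
    have "((\<lambda>t. t / sqrt (?q t)) \<longlongrightarrow> inverse ((2 * c) powr (1 / 2))) at_top"
      using assms by real_asymp
    then show ?thesis using assms by (simp add: powr_half_sqrt inverse_eq_divide)
  qed
  have "(\<integral>\<^sup>+t. ennreal ((2 * (a / ?p t) + c / ?q t) * (1 / (?p t * sqrt (?q t)))) * indicator {0..} t \<partial>lborel)
     = ennreal (H (1 / sqrt (2 * c)) - F 0)"
  proof (rule nn_integral_FTC_atLeast)
    have nz: "1 + K * v\<^sup>2 \<noteq> 0" for v
      using K mult_nonneg_nonneg[of K "v\<^sup>2"] zero_le_power2[of v] by linarith
    have "isCont H v" for v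
      unfolding H_def using K nz by (intro continuous_intros) auto
    then show "(F \<longlongrightarrow> H (1 / sqrt (2 * c))) at_top"
      unfolding F_def by (rule isCont_tendsto_compose) (rule v_lim)
  next
    fix x :: real assume x: "0 \<le> x"
    define z where "z = sqrt (?q x)"
    define v where "v = x / z"
    have q: "1 \<le> ?q x" and p: "1 \<le> ?p x" using x assms by simp_all
    have "0 < ?q x" using q by linarith
    then have z: "0 < z" "z\<^sup>2 = ?q x" by (simp_all add: z_def)
    have pq: "1 + K * v\<^sup>2 = ?p x / z\<^sup>2"
      using q by (simp add: v_def power_divide z(2)) (simp add: K_def field_simps)
    have dv: "((\<lambda>t. t / sqrt (?q t)) has_real_derivative 1 / z ^ 3) (at x)"
    proof -
      have "((\<lambda>t. t / sqrt (?q t)) has_real_derivative (z - x * (2 * x * c / z)) / z\<^sup>2) (at x)"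
        using q unfolding z_def by (auto intro!: derivative_eq_intros simp: power2_eq_square field_simps)
      also have "(z - x * (2 * x * c / z)) / z\<^sup>2 = (z\<^sup>2 - 2 * x\<^sup>2 * c) / z ^ 3"
        using z(1) by (simp add: field_simps power2_eq_square power3_eq_cube)
      also have "\<dots> = 1 / z ^ 3" by (simp add: z(2))
      finally show ?thesis .
    qed
    define m where "m = 1 + K * v\<^sup>2"
    have "0 < ?p x" using p by linarith
    then have m: "0 < m" unfolding m_def pq using z(1) by (intro divide_pos_pos) auto
    have dH: "(H has_real_derivative 2 * a\<^sup>2 / K * ((2 - m) / m\<^sup>2) - 2 * c\<^sup>2 / K + a / m) (at v)"
    proof -
      have k: "1 + (k * v)\<^sup>2 = m" by (simp add: m_def power_mult_distrib K)
      have d1: "((\<lambda>v. v / (1 + K * v\<^sup>2)) has_real_derivative (2 - m) / m\<^sup>2) (at v)"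
        using m unfolding m_def
        by (auto intro!: derivative_eq_intros simp: power2_eq_square)
      have d2: "((\<lambda>v. arctan (k * v)) has_real_derivative k / (1 + (k * v)\<^sup>2)) (at v)"
        by (auto intro!: derivative_eq_intros simp: divide_simps)
      show ?thesis
        unfolding H_def
        by (rule DERIV_cong[OF DERIV_add[OF DERIV_diff[OF DERIV_cmult[OF d1] DERIV_cmult[OF DERIV_ident]]
                DERIV_cmult[OF d2]]])
          (use K in \<open>simp add: k\<close>)
    qed
    have "(F has_real_derivative (2 * a\<^sup>2 / K * ((2 - m) / m\<^sup>2) - 2 * c\<^sup>2 / K + a / m) * (1 / z ^ 3)) (at x)"
      unfolding F_def
    proof (rule DERIV_chain2[where f = H, OF _ dv])
      have "x / sqrt (?q x) = v" by (simp add: v_def z_def)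
      then show "(H has_real_derivative 2 * a\<^sup>2 / K * ((2 - m) / m\<^sup>2) - 2 * c\<^sup>2 / K + a / m)
          (at (x / sqrt (?q x)))"
        using dH by simp
    qed
    also have "(2 * a\<^sup>2 / K * ((2 - m) / m\<^sup>2) - 2 * c\<^sup>2 / K + a / m) * (1 / z ^ 3)
        = (2 * (a / ?p x) + c / ?q x) * (1 / (?p x * sqrt (?q x)))"
    proof -
      have P: "?p x = m * z\<^sup>2" using z(1) by (simp add: m_def pq)
      \<comment> \<open>This ties \<open>K\<close> to the factor \<open>a - c * m\<close> of the
        combined numerator, so that the factor cancels and leaves \<open>z^2\<close> in the
        denominator.\<close>
      have rel: "a - c = (a - c * m) * z\<^sup>2"
      proof -
        have "c * (m * z\<^sup>2) = c * ?p x" by (simp only: P)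
        moreover have "a * z\<^sup>2 - c * ?p x = a - c" by (simp add: z(2) algebra_simps)
        ultimately show ?thesis by (simp add: algebra_simps)
      qed
      have "2 * a\<^sup>2 / K * ((2 - m) / m\<^sup>2) - 2 * c\<^sup>2 / K + a / m
          = (2 * a\<^sup>2 * (2 - m) - 2 * c\<^sup>2 * m\<^sup>2 + a * m * K) / (K * m\<^sup>2)"
        using K m by (simp add: field_simps power2_eq_square)
      also have "2 * a\<^sup>2 * (2 - m) - 2 * c\<^sup>2 * m\<^sup>2 + a * m * K = 2 * (a - c * m) * (2 * a + c * m)"
        by (simp add: K_def algebra_simps power2_eq_square)
      also have "2 * (a - c * m) * (2 * a + c * m) / (K * m\<^sup>2) = (2 * a + c * m) / (z\<^sup>2 * m\<^sup>2)"
      proof -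
        define d where "d = a - c * m"
        have "K = 2 * (d * z\<^sup>2)" by (simp add: K_def rel d_def)
        moreover have "d \<noteq> 0" using rel assms by (auto simp: d_def)
        ultimately show ?thesis unfolding d_def[symmetric] by simp
      qed
      finally have E: "2 * a\<^sup>2 / K * ((2 - m) / m\<^sup>2) - 2 * c\<^sup>2 / K + a / m = (2 * a + c * m) / (z\<^sup>2 * m\<^sup>2)" .
      show ?thesis
        unfolding E P z(2)[symmetric] using z(1) m by (simp add: field_simps power2_eq_square power3_eq_cube)
    qed
    finally show "(F has_real_derivative \<dots>) (at x)" .
    show "0 \<le> (2 * (a / ?p x) + c / ?q x) * (1 / (?p x * sqrt (?q x)))"
      using p q assms by (intro mult_nonneg_nonneg add_nonneg_nonneg) auto
  qed simp
  also have "F 0 = 0" by (simp add: F_def H_def)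
  also have "H (1 / sqrt (2 * c)) - 0 = sqrt (c / 2) + a / sqrt (2 * (a - c)) * arctan (sqrt ((a - c) / c))"
  proof -
    define v where "v = 1 / sqrt (2 * c)"
    have v: "v\<^sup>2 = 1 / (2 * c)" using assms by (simp add: v_def power_divide)
    have "1 + K * v\<^sup>2 = a / c" using assms by (simp add: v K_def field_simps)
    moreover have "k * v = sqrt ((a - c) / c)"
      unfolding k_def K_def v_def real_sqrt_mult real_sqrt_divide by simp
    moreover have "2 * a\<^sup>2 / K * (v / (a / c)) - 2 * c\<^sup>2 / K * v = c * v"
      using assms K by (simp add: field_simps power2_eq_square) (simp add: K_def algebra_simps)
    moreover have "c * v = sqrt (c / 2)"
      using assms by (simp add: v_def real_sqrt_mult real_sqrt_divide real_div_sqrt field_simps)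
    ultimately show ?thesis unfolding H_def v_def[symmetric] by (simp add: k_def K_def)
  qed
  finally show ?thesis .
qed

text \<open>Needed to read the closed form back from \<open>ennreal\<close> by
  \<open>enn2real\<close>. Elementary bounds on the two logarithms make the subtracted term at most
  \<open>a * (r * (1 + r) / 2)\<close>, which is at most \<open>a\<close>.\<close>

lemma E1_rotational_value_nonneg:
  assumes "0 < (c :: real)" "c < a"
  defines "r \<equiv> sqrt (1 - c / a)"
  shows "0 \<le> a - c * (ln ((1 + r) / (1 - r)) / (2 * r) - 1)"
proof -
  have r: "0 < r" "r < 1" "a * r\<^sup>2 = a - c"
    using assms by (auto simp: r_def field_simps)
  \<comment> \<open>The factor \<open>1 - r\<close> of \<open>c\<close> cancels the pole of the
    bound \<open>r / (1 - r)\<close> on the logarithm.\<close>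
  have c: "c = a * ((1 - r) * (1 + r))" using r by (simp add: algebra_simps power2_eq_square)
  have "ln ((1 + r) / (1 - r)) = ln (1 + r) + ln (1 / (1 - r))"
    using r by (simp add: ln_div)
  also have "\<dots> \<le> r + r / (1 - r)"
  proof (rule add_mono)
    show "ln (1 + r) \<le> r" using r by (intro ln_add_one_self_le_self) simp
    have "ln (1 / (1 - r)) \<le> 1 / (1 - r) - 1" using r by (intro ln_le_minus_one) simp
    also have "\<dots> = r / (1 - r)" using r by (simp add: field_simps)
    finally show "ln (1 / (1 - r)) \<le> r / (1 - r)" .
  qed
  finally have "ln ((1 + r) / (1 - r)) / (2 * r) - 1 \<le> (r + r / (1 - r)) / (2 * r) - 1"
    using r by (intro diff_right_mono divide_right_mono) auto
  also have "\<dots> = r / (2 * (1 - r))"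
    using r by (simp add: divide_simps) (simp add: algebra_simps)
  finally have "c * (ln ((1 + r) / (1 - r)) / (2 * r) - 1) \<le> c * (r / (2 * (1 - r)))"
    using assms by (intro mult_left_mono) auto
  also have "\<dots> = a * (r * (1 + r) / 2)"
    unfolding c using r by (simp add: divide_simps)
  also have "\<dots> \<le> a * 1"
  proof (intro mult_left_mono)
    have "r * (1 + r) \<le> 1 * 2" using r by (intro mult_mono) auto
    then show "r * (1 + r) / 2 \<le> 1" by simp
  qed (use assms in simp)
  finally show ?thesis by simp
qed

section \<open>Both expectations for two equal weights and a smaller third one\<close>

context prob_space
begin

lemma E1_rotational:
  assumes \<gamma>: "indep_std_normals M \<gamma> {1, 2, 3}" and c: "0 < c" "c < a"
  defines "r \<equiv> sqrt (1 - c / a)"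
  shows "E1 M \<gamma> a a c = a - c * (ln ((1 + r) / (1 - r)) / (2 * r) - 1)"
proof -
  have [measurable]: "\<And>i. i \<in> {1, 2, 3} \<Longrightarrow> \<gamma> i \<in> borel_measurable M"
    using \<gamma> by (auto simp: indep_std_normals_def indep_vars_def)
  define \<alpha> where "\<alpha> i = (if i = 3 then c else a)" for i :: nat
  let ?I = "{1, 2, 3 :: nat}"
  let ?N = "\<lambda>\<omega>. \<Sum>i\<in>?I. (\<alpha> i)\<^sup>2 * (\<gamma> i \<omega>)\<^sup>2" and ?D = "\<lambda>\<omega>. \<Sum>i\<in>?I. \<alpha> i * (\<gamma> i \<omega>)\<^sup>2"
  have \<alpha>: "0 < \<alpha> i" for i using c by (simp add: \<alpha>_def)
  have "E1 M \<gamma> a a c = (LINT \<omega>|M. ?N \<omega> / ?D \<omega>)"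
    by (simp add: E1_def \<alpha>_def add.assoc)
  also have "\<dots> = enn2real (\<integral>\<^sup>+\<omega>. ennreal (?N \<omega> / ?D \<omega>) \<partial>M)"
  proof (rule integral_eq_nn_integral)
    show "(\<lambda>\<omega>. ?N \<omega> / ?D \<omega>) \<in> borel_measurable M" by measurable
    show "AE \<omega> in M. 0 \<le> ?N \<omega> / ?D \<omega>"
      using \<alpha> by (intro AE_I2 divide_nonneg_nonneg sum_nonneg mult_nonneg_nonneg) (auto intro: less_imp_le)
  qed
  also have "(\<integral>\<^sup>+\<omega>. ennreal (?N \<omega> / ?D \<omega>) \<partial>M)
      = (\<integral>\<^sup>+\<omega>. (\<integral>\<^sup>+t. ennreal (?N \<omega> * exp (- t * ?D \<omega>)) * indicator {0..} t \<partial>lborel) \<partial>M)"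
  \<comment> \<open>The representation holds at every point, not just almost everywhere: if the
    denominator is 0, all three normals vanish there and so does the numerator.\<close>
  proof (intro nn_integral_cong nn_integral_exp_atLeast_0[symmetric])
    fix \<omega>
    show "0 \<le> ?N \<omega>" by (intro sum_nonneg) auto
    show "0 \<le> ?D \<omega>" using \<alpha> by (intro sum_nonneg mult_nonneg_nonneg less_imp_le[OF \<alpha>]) auto
    assume "?D \<omega> = 0"
    moreover have "\<alpha> i \<noteq> 0" "0 \<le> \<alpha> i" for i using \<alpha>[of i] by auto
    ultimately have "\<forall>i\<in>?I. \<gamma> i \<omega> = 0"
      by (subst (asm) sum_nonneg_eq_0_iff) auto
    then show "?N \<omega> = 0" by (intro sum.neutral) auto
  qed
  also have "\<dots> = (\<integral>\<^sup>+t. ennreal ((\<Sum>i\<in>?I. (\<alpha> i)\<^sup>2 / (1 + 2 * (t * \<alpha> i))) *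
      (\<Prod>i\<in>?I. 1 / sqrt (1 + 2 * (t * \<alpha> i)))) * indicator {0..} t \<partial>lborel)"
    using \<alpha> by (intro nn_integral_indep_std_normals_mixture[OF \<gamma>]) (auto intro: less_imp_le)
  also have "\<dots> = (\<integral>\<^sup>+t. ennreal ((2 * (a\<^sup>2 / (1 + 2 * (t * a))) + c\<^sup>2 / (1 + 2 * (t * c))) *
        (1 / ((1 + 2 * (t * a)) * sqrt (1 + 2 * (t * c))))) * indicator {0..} t \<partial>lborel)"
  proof (intro nn_integral_cong)
    fix t :: real
    \<comment> \<open>The two equal weights merge their square roots, so that only the root
      belonging to \<open>c\<close> is left.\<close>
    have "sqrt (1 + 2 * (t * a)) * sqrt (1 + 2 * (t * a)) = 1 + 2 * (t * a)" if "0 \<le> t"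
      using that c by simp
    then show "ennreal ((\<Sum>i\<in>?I. (\<alpha> i)\<^sup>2 / (1 + 2 * (t * \<alpha> i))) *
        (\<Prod>i\<in>?I. 1 / sqrt (1 + 2 * (t * \<alpha> i)))) * indicator {0..} t
      = ennreal ((2 * (a\<^sup>2 / (1 + 2 * (t * a))) + c\<^sup>2 / (1 + 2 * (t * c))) *
        (1 / ((1 + 2 * (t * a)) * sqrt (1 + 2 * (t * c))))) * indicator {0..} t"
      by (cases "0 \<le> t") (simp_all add: \<alpha>_def mult.assoc[symmetric])
  qed
  also have "\<dots> = ennreal (a - c * (ln ((1 + r) / (1 - r)) / (2 * r) - 1))"
    unfolding r_def using c by (rule nn_integral_E1_kernel)
  also have "enn2real \<dots> = a - c * (ln ((1 + r) / (1 - r)) / (2 * r) - 1)"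
    unfolding r_def using c by (intro enn2real_ennreal E1_rotational_value_nonneg)
  finally show ?thesis .
qed

lemma E2_rotational:
  assumes \<gamma>: "indep_std_normals M \<gamma> {1, 2, 3}" and c: "0 < c" "c < a"
  shows "E2 M \<gamma> a a c
    = 2 / sqrt pi * (sqrt (c / 2) + a / sqrt (2 * (a - c)) * arctan (sqrt ((a - c) / c)))"
    (is "_ = 2 / sqrt pi * ?V")
proof -
  have [measurable]: "\<And>i. i \<in> {1, 2, 3} \<Longrightarrow> \<gamma> i \<in> borel_measurable M"
    using \<gamma> by (auto simp: indep_std_normals_def indep_vars_def)
  define \<alpha> where "\<alpha> i = (if i = 3 then c else a)" for i :: nat
  let ?I = "{1, 2, 3 :: nat}"
  let ?D = "\<lambda>\<omega>. \<Sum>i\<in>?I. \<alpha> i * (\<gamma> i \<omega>)\<^sup>2"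
  have \<alpha>: "0 \<le> \<alpha> i" for i using c by (simp add: \<alpha>_def)
  have D: "0 \<le> ?D \<omega>" for \<omega> using \<alpha> by (intro sum_nonneg) auto
  \<comment> \<open>The factor \<open>sqrt pi / 2\<close> is the constant of the Gaussian
    representation of the square root; it is divided out at the end.\<close>
  have "sqrt pi / 2 * E2 M \<gamma> a a c = (LINT \<omega>|M. sqrt pi / 2 * sqrt (?D \<omega>))"
    by (simp add: E2_def \<alpha>_def add.assoc)
  also have "\<dots> = enn2real (\<integral>\<^sup>+\<omega>. ennreal (sqrt pi / 2 * sqrt (?D \<omega>)) \<partial>M)"
  proof (rule integral_eq_nn_integral)
    show "(\<lambda>\<omega>. sqrt pi / 2 * sqrt (?D \<omega>)) \<in> borel_measurable M" by measurable
    show "AE \<omega> in M. 0 \<le> sqrt pi / 2 * sqrt (?D \<omega>)"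
      using D by (intro AE_I2 mult_nonneg_nonneg real_sqrt_ge_zero) auto
  qed
  also have "(\<integral>\<^sup>+\<omega>. ennreal (sqrt pi / 2 * sqrt (?D \<omega>)) \<partial>M)
      = (\<integral>\<^sup>+\<omega>. (\<integral>\<^sup>+t. ennreal (?D \<omega> * exp (- t\<^sup>2 * ?D \<omega>)) * indicator {0..} t \<partial>lborel) \<partial>M)"
    using D by (intro nn_integral_cong nn_integral_gauss_atLeast_0[symmetric])
  also have "\<dots> = (\<integral>\<^sup>+t. ennreal ((\<Sum>i\<in>?I. \<alpha> i / (1 + 2 * (t\<^sup>2 * \<alpha> i))) *
      (\<Prod>i\<in>?I. 1 / sqrt (1 + 2 * (t\<^sup>2 * \<alpha> i)))) * indicator {0..} t \<partial>lborel)"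
    using \<alpha> by (intro nn_integral_indep_std_normals_mixture[OF \<gamma>]) auto
  also have "\<dots> = (\<integral>\<^sup>+t. ennreal ((2 * (a / (1 + 2 * (t\<^sup>2 * a))) + c / (1 + 2 * (t\<^sup>2 * c))) *
        (1 / ((1 + 2 * (t\<^sup>2 * a)) * sqrt (1 + 2 * (t\<^sup>2 * c))))) * indicator {0..} t \<partial>lborel)"
  proof (intro nn_integral_cong)
    fix t :: real
    have "sqrt (1 + 2 * (t\<^sup>2 * a)) * sqrt (1 + 2 * (t\<^sup>2 * a)) = 1 + 2 * (t\<^sup>2 * a)"
      using c by simp
    then show "ennreal ((\<Sum>i\<in>?I. \<alpha> i / (1 + 2 * (t\<^sup>2 * \<alpha> i))) *
        (\<Prod>i\<in>?I. 1 / sqrt (1 + 2 * (t\<^sup>2 * \<alpha> i)))) * indicator {0..} t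
      = ennreal ((2 * (a / (1 + 2 * (t\<^sup>2 * a))) + c / (1 + 2 * (t\<^sup>2 * c))) *
        (1 / ((1 + 2 * (t\<^sup>2 * a)) * sqrt (1 + 2 * (t\<^sup>2 * c))))) * indicator {0..} t"
      by (simp add: \<alpha>_def mult.assoc[symmetric])
  qed
  also have "\<dots> = ennreal ?V"
    using c by (rule nn_integral_E2_kernel)
  also have "enn2real \<dots> = ?V"
    using c by (intro enn2real_ennreal) (simp add: zero_le_arctan_iff)
  finally show ?thesis by (simp add: field_simps)
qed

end

section \<open>Translation of the closed forms into logarithm and arcsine in \<xi> and s\<close>

theorem proposition1p3p1:
  fixes M :: "'a measure" and \<gamma> :: "nat \<Rightarrow> 'a \<Rightarrow> real" and \<xi> s :: real
  assumes "prob_space M"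
    and "indep_std_normals M \<gamma> {1, 2, 3}"
    and "\<xi> > 0" and "s \<noteq> 0" and "\<xi> > \<bar>s\<bar>"
  shows "E1 M \<gamma> (\<xi>\<^sup>2) (\<xi>\<^sup>2) (s\<^sup>2) =
      \<xi>\<^sup>2 * (1 + s\<^sup>2 / \<xi>\<^sup>2 * (1 / sqrt (1 - s\<^sup>2 / \<xi>\<^sup>2)) * ln (\<bar>s\<bar> / \<xi>)
        + s\<^sup>2 / \<xi>\<^sup>2 * (1 - 1 / sqrt (1 - s\<^sup>2 / \<xi>\<^sup>2) * ln (1 + sqrt (1 - s\<^sup>2 / \<xi>\<^sup>2))))
    \<and> E2 M \<gamma> (\<xi>\<^sup>2) (\<xi>\<^sup>2) (s\<^sup>2) =
      \<xi> * sqrt (2 / pi) * (arcsin (sqrt (1 - s\<^sup>2 / \<xi>\<^sup>2)) / sqrt (1 - s\<^sup>2 / \<xi>\<^sup>2))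
        + \<bar>s\<bar> * sqrt (2 / pi)"
proof -
  interpret prob_space M by fact
  define r where "r = sqrt (1 - s\<^sup>2 / \<xi>\<^sup>2)"
  have s: "0 < s\<^sup>2" "s\<^sup>2 < \<xi>\<^sup>2"
    using assms(3-5) by (auto simp: abs_le_square_iff[symmetric] not_le[symmetric])
  have r2: "r\<^sup>2 = 1 - s\<^sup>2 / \<xi>\<^sup>2" and r: "0 < r" "r < 1"
    using s assms(3) by (auto simp: r_def)
  \<comment> \<open>Since (1 + r) (1 - r) = (|s| / \<xi>)^2, extending the fraction by 1 + r turns
    it into a quotient of squares; the resulting factor 2 cancels the one in
    \<open>2 * r\<close>.\<close>
  have L: "ln ((1 + r) / (1 - r)) / (2 * r) = 1 / r * ln (1 + r) - 1 / r * ln (\<bar>s\<bar> / \<xi>)"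
  proof -
    have "(1 + r) / (1 - r) = (1 + r)\<^sup>2 / (\<bar>s\<bar> / \<xi>)\<^sup>2"
    proof -
      have "(\<bar>s\<bar> / \<xi>)\<^sup>2 = (1 + r) * (1 - r)"
        using r2 by (simp add: power_divide algebra_simps power2_eq_square)
      then show ?thesis using r by (simp add: power2_eq_square)
    qed
    also have "ln \<dots> = 2 * ln (1 + r) - 2 * ln (\<bar>s\<bar> / \<xi>)"
      using r assms by (subst ln_div) (auto simp: ln_realpow)
    finally show ?thesis using r by (simp add: field_simps)
  qed
  have "E1 M \<gamma> (\<xi>\<^sup>2) (\<xi>\<^sup>2) (s\<^sup>2) = \<xi>\<^sup>2 * (1 + s\<^sup>2 / \<xi>\<^sup>2 * (1 / r) * ln (\<bar>s\<bar> / \<xi>)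
        + s\<^sup>2 / \<xi>\<^sup>2 * (1 - 1 / r * ln (1 + r)))"
    unfolding E1_rotational[OF assms(2) s, folded r_def] L using r assms(3) by (simp add: field_simps)
  moreover have "E2 M \<gamma> (\<xi>\<^sup>2) (\<xi>\<^sup>2) (s\<^sup>2)
      = \<xi> * sqrt (2 / pi) * (arcsin r / r) + \<bar>s\<bar> * sqrt (2 / pi)"
  proof -
    have d: "sqrt (\<xi>\<^sup>2 - s\<^sup>2) = \<xi> * r"
    proof -
      have "\<xi>\<^sup>2 - s\<^sup>2 = (\<xi> * r)\<^sup>2" using assms(3) by (simp add: power_mult_distrib r2 field_simps)
      then show ?thesis using r assms(3) by simp
    qed
    \<comment> \<open>Here \<open>sqrt (1 - r^2)\<close> is |s| / \<xi>, so the argument becomes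
      \<xi> r / |s|, which is the argument of \<open>arctan\<close> in
      \<open>E2_rotational\<close>.\<close>
    have "arcsin r = arctan (r / sqrt (1 - r\<^sup>2))" using r by (intro arcsin_arctan) auto
    also have "sqrt (1 - r\<^sup>2) = \<bar>s\<bar> / \<xi>" using assms(3) by (simp add: r2 real_sqrt_divide)
    finally have "arctan (sqrt ((\<xi>\<^sup>2 - s\<^sup>2) / s\<^sup>2)) = arcsin r"
      using d by (simp add: real_sqrt_divide mult.commute)
    moreover have "sqrt (2 * (\<xi>\<^sup>2 - s\<^sup>2)) = sqrt 2 * (\<xi> * r)" by (simp only: real_sqrt_mult d)
    ultimately show ?thesis
      unfolding E2_rotational[OF assms(2) s] using r assms(3)
      by (simp add: real_sqrt_divide real_sqrt_mult field_simps power2_eq_square)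
  qed
  ultimately show ?thesis by (simp only: r_def)
qed

end
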